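(* Let $A\in\mathbb{R}^{n\times n}$ with $n=2\ell$ be nonsingular and skew-symmetric ($A^T=-A$). Then there exist matrices $U,V\in\mathbb{R}^{n\times \ell}$ that are orthonormal and biorthogonal, $$U^TU=I,\qquad V^TV=I,\qquad U^TV=\mathbf{0},$$ and a diagonal matrix $\Sigma=\mathrm{diag}\{\sigma_1,\dots,\sigma_\ell\}\in\mathbb{R}^{\ell\times\ell}$ with $\sigma_1,\dots,\sigma_\ell>0$, such that the spectral decomposition of $A$ is $$A=X\Lambda X^H,\qquad X=\begin{bmatrix}\frac{1}{\sqrt2}(U+\mathrm{i}V)&\frac{1}{\sqrt2}(U-\mathrm{i}V)\end{bmatrix},\qquad \Lambda=\mathrm{diag}\{\mathrm{i}\Sigma,-\mathrm{i}\Sigma\},$$ and the singular value decomposition (SVD) of $A$ is $$A=\begin{bmatrix}U&V\end{bmatrix}\begin{bmatrix}\Sigma&\\&\Sigma\end{bmatrix}\begin{bmatrix}V&-U\end{bmatrix}^T .$$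
   Context: $\mathrm{i}$ is the imaginary unit and $X^H$ denotes the conjugate transpose. "Spectral decomposition" means that $X$ is unitary and $\Lambda$ is the diagonal matrix of eigenvalues of $A$; "SVD" means that $[U\ V]$ and $[V\ -U]$ are orthogonal matrices and the middle factor is diagonal with nonnegative entries (the ordering of the singular values is not prescribed). *)

theory Defs
  imports Complex_Main "Jordan_Normal_Form.Schur_Decomposition"
begin

text \<open>The library predicates \<open>orthogonal_mat\<close> and \<open>corthogonal_mat\<close> only ask for
  pairwise orthogonal nonzero columns, with no normalisation and no squareness, so they cannot be
  used for orthogonal and unitary matrices.\<close>

definition orthonormal_square_mat :: "real mat \<Rightarrow> bool" where
  "orthonormal_square_mat Q \<longleftrightarrow>
     square_mat Q \<and> transpose_mat Q * Q = 1\<^sub>m (dim_row Q) \<and> Q * transpose_mat Q = 1\<^sub>m (dim_row Q)"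

definition unitary_mat :: "complex mat \<Rightarrow> bool" where
  "unitary_mat X \<longleftrightarrow>
     square_mat X \<and> mat_adjoint X * X = 1\<^sub>m (dim_row X) \<and> X * mat_adjoint X = 1\<^sub>m (dim_row X)"

text \<open>The block row \<open>[A B]\<close>, for \<open>A\<close> and \<open>B\<close> with the same number of rows.\<close>

definition block_row :: "'a :: zero mat \<Rightarrow> 'a mat \<Rightarrow> 'a mat" where
  "block_row A B = four_block_mat A B (0\<^sub>m 0 (dim_col A)) (0\<^sub>m 0 (dim_col B))"

definition block_diag2 :: "'a :: zero mat \<Rightarrow> 'a mat \<Rightarrow> 'a mat" where
  "block_diag2 A B =
     four_block_mat A (0\<^sub>m (dim_row A) (dim_col B)) (0\<^sub>m (dim_row B) (dim_col A)) B"

abbreviation cmat :: "real mat \<Rightarrow> complex mat" where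
  "cmat \<equiv> map_mat complex_of_real"

text \<open>The condition on the characteristic polynomial says that the diagonal of \<open>L\<close> lists the
  eigenvalues of \<open>A\<close> with their algebraic multiplicities.\<close>

definition spectral_decomposition :: "complex mat \<Rightarrow> complex mat \<Rightarrow> complex mat \<Rightarrow> bool" where
  "spectral_decomposition A X L \<longleftrightarrow>
     square_mat A \<and>
     X \<in> carrier_mat (dim_row A) (dim_row A) \<and> L \<in> carrier_mat (dim_row A) (dim_row A) \<and>
     unitary_mat X \<and> diagonal_mat L \<and>
     char_poly A = (\<Prod>a\<leftarrow>diag_mat L. [:- a, 1:]) \<and>
     A = X * L * mat_adjoint X"

text \<open>\<open>A = P S Q\<^sup>T\<close> with the singular values on the diagonal of \<open>S\<close> in arbitrary order.\<close>

definition singular_value_decomposition ::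
    "real mat \<Rightarrow> real mat \<Rightarrow> real mat \<Rightarrow> real mat \<Rightarrow> bool" where
  "singular_value_decomposition A P S Q \<longleftrightarrow>
     P \<in> carrier_mat (dim_row A) (dim_row A) \<and>
     S \<in> carrier_mat (dim_row A) (dim_col A) \<and>
     Q \<in> carrier_mat (dim_col A) (dim_col A) \<and>
     orthonormal_square_mat P \<and> orthonormal_square_mat Q \<and>
     diagonal_mat S \<and> (\<forall>i < min (dim_row A) (dim_col A). S $$ (i, i) \<ge> 0) \<and>
     A = P * S * transpose_mat Q"

end

theory Submission
  imports Defs
begin

text \<open>
  Orthonormal pairs \<open>u\<^sub>i, v\<^sub>i\<close> with \<open>A u\<^sub>i = - \<sigma>\<^sub>i v\<^sub>i\<close> and \<open>A v\<^sub>i = \<sigma>\<^sub>i u\<^sub>i\<close> are split off one at a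
  time. After \<open>k < l\<close> pairs, the deflated matrix
  \<open>B = A - \<Sum>\<^sub>i \<sigma>\<^sub>i (u\<^sub>i v\<^sub>i\<^sup>T - v\<^sub>i u\<^sub>i\<^sup>T)\<close> is skew-symmetric, kills the pairs found so far and agrees with
  \<open>A\<close> on their orthogonal complement, so it is nonzero. A nonzero real skew-symmetric matrix has a
  nonzero eigenvalue, because the squares of its eigenvalues sum to \<open>tr (B\<^sup>2) = - \<Sum>\<^sub>i\<^sub>j B\<^sub>i\<^sub>j\<^sup>2\<close>; this eigenvalue is
  purely imaginary, and the real and imaginary parts of an eigenvector give the next pair, which is
  orthogonal to the kernel of \<open>B\<close>. For \<open>k = l\<close> the vectors form an orthonormal basis, and
  multiplying \<open>A\<close> by \<open>U U\<^sup>T + V V\<^sup>T = I\<close> gives \<open>A = U \<Sigma> V\<^sup>T - V \<Sigma> U\<^sup>T\<close>, of which both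
  decompositions are rewritings.
\<close>

section \<open>Nonzero eigenvalues of real skew-symmetric matrices\<close>

lemma skew_scalar_prod:
  fixes B :: "real mat"
  assumes B: "B \<in> carrier_mat n n" and skew: "transpose_mat B = - B"
    and x: "x \<in> carrier_vec n" and y: "y \<in> carrier_vec n"
  shows "x \<bullet> (B *\<^sub>v y) = - ((B *\<^sub>v x) \<bullet> y)"
proof -
  have "x \<bullet> (B *\<^sub>v y) = (transpose_mat B *\<^sub>v x) \<bullet> y"
    using transpose_vec_mult_scalar[OF B y x] by simp
  also have "transpose_mat B *\<^sub>v x = - (B *\<^sub>v x)"
    unfolding skew using B x by (intro eq_vecI) auto
  finally show ?thesis
    using B x y by simp
qed

lemma trace_mult_comm:
  fixes P Q :: "'a :: comm_semiring_0 mat"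
  assumes "P \<in> carrier_mat n m" "Q \<in> carrier_mat m n"
  shows "(\<Sum>i<n. (P * Q) $$ (i, i)) = (\<Sum>i<m. (Q * P) $$ (i, i))"
proof -
  have "(\<Sum>i<n. (P * Q) $$ (i, i)) = (\<Sum>i<n. \<Sum>j<m. P $$ (i, j) * Q $$ (j, i))"
    using assms by (intro sum.cong) (auto simp: scalar_prod_def lessThan_atLeast0)
  also have "\<dots> = (\<Sum>j<m. \<Sum>i<n. Q $$ (j, i) * P $$ (i, j))"
    by (subst sum.swap) (simp add: mult.commute)
  also have "\<dots> = (\<Sum>i<m. (Q * P) $$ (i, i))"
    using assms by (intro sum.cong) (auto simp: scalar_prod_def lessThan_atLeast0)
  finally show ?thesis .
qed

text \<open>Writing \<open>A = P * T * Q\<close> with \<open>Q * P = 1\<close>, the inner factors of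
  \<open>A * A\<close> cancel, and cyclicity of the trace brings the outer \<open>P\<close> next to
  \<open>Q\<close>.\<close>

lemma trace_similar_square:
  fixes A T :: "'a :: comm_ring_1 mat"
  assumes A: "A \<in> carrier_mat n n" and "similar_mat A T"
  shows "(\<Sum>i<n. (A * A) $$ (i, i)) = (\<Sum>i<n. (T * T) $$ (i, i))"
proof -
  from \<open>similar_mat A T\<close> obtain P Q where "similar_mat_wit A T P Q"
    unfolding similar_mat_def by blast
  note w = similar_mat_witD2[OF A this]
  have assoc: "X * Y * Z = X * (Y * Z)"
    if "X \<in> carrier_mat n n" "Y \<in> carrier_mat n n" "Z \<in> carrier_mat n n" for X Y Z :: "'a mat"
    using that by (rule assoc_mult_mat)
  note simps = assoc mult_carrier_mat[of _ n n] w(5-7)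
  have "A * A = P * (T * ((Q * P) * (T * Q)))"
    unfolding w(3) by (simp add: simps)
  also have "\<dots> = P * (T * (T * Q))"
    using w(5,7) by (simp add: w(2))
  finally have "(\<Sum>i<n. (A * A) $$ (i, i)) = (\<Sum>i<n. (T * (T * Q) * P) $$ (i, i))"
    using trace_mult_comm[of P n n "T * (T * Q)"] w(5-7) by simp
  also have "T * (T * Q) * P = T * T"
    by (simp add: simps) (use w(5) in \<open>simp add: w(2)\<close>)
  finally show ?thesis .
qed

text \<open>If 0 were the only eigenvalue, a complex Schur form would be strictly upper triangular,
  so the trace of \<open>B * B\<close> would vanish. Skew-symmetry makes this trace minus the sum of
  the squared entries of \<open>B\<close>.\<close>

lemma skew_nonzero_eigenvalue:
  fixes B :: "real mat"
  assumes B: "B \<in> carrier_mat n n" and skew: "transpose_mat B = - B" and "B \<noteq> 0\<^sub>m n n"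
  shows "\<exists>a. a \<noteq> 0 \<and> eigenvalue (cmat B) a"
proof (rule ccontr)
  assume no_ev: "\<not> ?thesis"
  have C: "cmat B \<in> carrier_mat n n"
    using B by simp
  obtain as where "char_poly (cmat B) = (\<Prod>a\<leftarrow>as. [:- a, 1:])"
    using char_poly_factorized[OF C] by blast
  from schur_decomposition_exists[OF C this] obtain T where T: "T \<in> carrier_mat n n"
    and ut: "upper_triangular T" and sim: "similar_mat (cmat B) T"
    by blast
  have T_diag: "T $$ (i, i) = 0" if "i < n" for i
  proof -
    have "poly (char_poly T) (T $$ (i, i)) = 0"
      using that T unfolding char_poly_upper_triangular[OF T ut]
      by (auto simp: poly_prod_list prod_list_zero_iff diag_mat_def)
    hence "eigenvalue (cmat B) (T $$ (i, i))"
      by (simp add: eigenvalue_root_char_poly[OF C] char_poly_similar[OF sim])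
    thus ?thesis
      using no_ev by blast
  qed
  \<comment> \<open>For \<open>i \<noteq> k\<close> one of the two entries lies below the diagonal;
    for \<open>i = k\<close> both lie on it.\<close>
  have "T $$ (i, k) * T $$ (k, i) = 0" if "i < n" "k < n" for i k
    using that T T_diag upper_triangularD[OF ut] by (cases i k rule: linorder_cases) auto
  hence "(\<Sum>i<n. (T * T) $$ (i, i)) = 0"
    using T by (auto simp: scalar_prod_def simp del: mult_eq_0_iff intro!: sum.neutral)
  hence "(\<Sum>i<n. (cmat B * cmat B) $$ (i, i)) = 0"
    by (simp add: trace_similar_square[OF C sim])
  also have "(\<Sum>i<n. (cmat B * cmat B) $$ (i, i)) = of_real (\<Sum>i<n. \<Sum>k<n. B $$ (i, k) * B $$ (k, i))"
    using B by (simp add: scalar_prod_def lessThan_atLeast0)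
  finally have "(\<Sum>i<n. \<Sum>k<n. B $$ (i, k) * B $$ (k, i)) = 0"
    by (simp only: of_real_eq_0_iff)
  also have "(\<Sum>i<n. \<Sum>k<n. B $$ (i, k) * B $$ (k, i)) = (\<Sum>i<n. \<Sum>k<n. - (B $$ (i, k))\<^sup>2)"
  proof (intro sum.cong refl)
    fix i k assume "i \<in> {..<n}" "k \<in> {..<n}"
    hence "B $$ (k, i) = - B $$ (i, k)"
      using arg_cong[OF skew, of "\<lambda>M. M $$ (i, k)"] B by auto
    thus "B $$ (i, k) * B $$ (k, i) = - (B $$ (i, k))\<^sup>2"
      by (simp add: power2_eq_square)
  qed
  finally have "(\<Sum>i<n. \<Sum>k<n. (B $$ (i, k))\<^sup>2) = 0"
    by (simp add: sum_negf)
  hence "B $$ (i, k) = 0" if "i < n" "k < n" for i k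
    using that by (auto simp: sum_nonneg_eq_0_iff sum_nonneg)
  hence "B = 0\<^sub>m n n"
    using B by (intro eq_matI) auto
  with \<open>B \<noteq> 0\<^sub>m n n\<close> show False ..
qed

section \<open>From a complex eigenvector to a real orthonormal pair\<close>

lemma scalar_prod_self_pos:
  fixes x :: "real vec"
  assumes "x \<in> carrier_vec n"
  shows "x \<bullet> x \<ge> 0" "x \<noteq> 0\<^sub>v n \<Longrightarrow> x \<bullet> x > 0"
  using conjugate_square_ge_0_vec[of x] conjugate_square_greater_0_vec[OF assms] by auto

text \<open>For an eigenvector \<open>x + \<i> y\<close> with nonzero eigenvalue \<open>a\<close>,
  skew-symmetry forces \<open>a\<close> to be purely imaginary and \<open>x\<close>,
  \<open>y\<close> to be orthogonal and of equal length. Normalising them yields the pair, with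
  \<open>s = \<bar>Im a\<bar>\<close>.\<close>

lemma skew_singular_pair:
  fixes B :: "real mat"
  assumes B: "B \<in> carrier_mat n n" and skew: "transpose_mat B = - B" and "B \<noteq> 0\<^sub>m n n"
  obtains u v s where "u \<in> carrier_vec n" "v \<in> carrier_vec n" "s > 0"
    "u \<bullet> u = 1" "v \<bullet> v = 1" "u \<bullet> v = 0"
    "B *\<^sub>v u = (- s) \<cdot>\<^sub>v v" "B *\<^sub>v v = s \<cdot>\<^sub>v u"
proof -
  obtain a z where "a \<noteq> 0" and z: "eigenvector (cmat B) z a"
    using skew_nonzero_eigenvalue[OF assms] unfolding eigenvalue_def by blast
  define x where "x = map_vec Re z"
  define y where "y = map_vec Im z"
  from z B have zc: "z \<in> carrier_vec n" and z0: "z \<noteq> 0\<^sub>v n" and ev: "cmat B *\<^sub>v z = a \<cdot>\<^sub>v z"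
    unfolding eigenvector_def by auto
  have x: "x \<in> carrier_vec n" and y: "y \<in> carrier_vec n"
    using zc unfolding x_def y_def by auto
  \<comment> \<open>Since \<open>B\<close> is real, the real and imaginary parts of these scalar
    equations describe the action of \<open>B\<close> on \<open>x\<close> and
    \<open>y\<close>.\<close>
  have row_eq: "(\<Sum>j = 0..<n. of_real (B $$ (i, j)) * z $ j) = a * z $ i" if "i < n" for i
    using arg_cong[OF ev, of "\<lambda>w. w $ i"] that B zc by (auto simp: scalar_prod_def)
  have Bx: "B *\<^sub>v x = Re a \<cdot>\<^sub>v x - Im a \<cdot>\<^sub>v y"
    using arg_cong[OF row_eq, of _ Re] B zc
    by (intro eq_vecI) (auto simp: x_def y_def scalar_prod_def)
  have By: "B *\<^sub>v y = Im a \<cdot>\<^sub>v x + Re a \<cdot>\<^sub>v y"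
    using arg_cong[OF row_eq, of _ Im] B zc
    by (intro eq_vecI) (auto simp: x_def y_def scalar_prod_def)
  \<comment> \<open>By skew-symmetry this number equals its own negative.\<close>
  have xBx: "x \<bullet> (B *\<^sub>v x) = 0"
    using skew_scalar_prod[OF B skew x x] B x comm_scalar_prod[of x n "B *\<^sub>v x"] by auto
  have yBy: "y \<bullet> (B *\<^sub>v y) = 0"
    using skew_scalar_prod[OF B skew y y] B y comm_scalar_prod[of y n "B *\<^sub>v y"] by auto
  have xBy: "x \<bullet> (B *\<^sub>v y) = - ((B *\<^sub>v x) \<bullet> y)"
    by (rule skew_scalar_prod[OF B skew x y])
  have yx: "y \<bullet> x = x \<bullet> y"
    by (rule comm_scalar_prod[OF y x])
  have e1: "Re a * (x \<bullet> x) = Im a * (x \<bullet> y)"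
    using xBx x y unfolding Bx by (simp add: scalar_prod_minus_distrib[of _ n])
  have e2: "Im a * (x \<bullet> y) + Re a * (y \<bullet> y) = 0"
    using yBy x y unfolding By by (simp add: scalar_prod_add_distrib[of _ n] yx)
  have ne: "x \<noteq> 0\<^sub>v n \<or> y \<noteq> 0\<^sub>v n"
  proof (rule ccontr)
    assume "\<not> ?thesis"
    hence "Re (z $ i) = 0 \<and> Im (z $ i) = 0" if "i < n" for i
      using that zc unfolding x_def y_def by (auto dest!: arg_cong[of _ _ "\<lambda>w. w $ i"])
    hence "z = 0\<^sub>v n"
      using zc by (intro eq_vecI) (auto simp: complex_eq_iff)
    with z0 show False ..
  qed
  have pos: "x \<bullet> x + y \<bullet> y > 0"
    using ne scalar_prod_self_pos[OF x] scalar_prod_self_pos[OF y] by (auto simp: add_pos_nonneg add_nonneg_pos)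
  \<comment> \<open>Adding \<open>e1\<close> and \<open>e2\<close> cancels the mixed term
    \<open>Im a * (x \<bullet> y)\<close>.\<close>
  have "Re a * (x \<bullet> x + y \<bullet> y) = 0"
    using e1 e2 by (simp add: algebra_simps)
  hence Re0: "Re a = 0"
    using pos by simp
  hence Im0: "Im a \<noteq> 0"
    using \<open>a \<noteq> 0\<close> by (simp add: complex_eq_iff)
  have xy: "x \<bullet> y = 0"
    using e1 Re0 Im0 by simp
  have Bx': "B *\<^sub>v x = (- Im a) \<cdot>\<^sub>v y" and By': "B *\<^sub>v y = Im a \<cdot>\<^sub>v x"
    unfolding Bx By Re0 using x y by (auto intro!: eq_vecI)
  \<comment> \<open>With the simplified actions, \<open>xBy\<close> reads
    \<open>Im a * (x \<bullet> x) = Im a * (y \<bullet> y)\<close>.\<close>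
  have eq: "x \<bullet> x = y \<bullet> y"
    using xBy x y Im0 unfolding Bx' By' by simp
  define r where "r = sqrt (x \<bullet> x)"
  have "x \<bullet> x > 0"
    using pos eq by simp
  hence r: "r > 0" "r * r = x \<bullet> x"
    unfolding r_def by auto
  \<comment> \<open>\<open>Im a\<close> may be negative. Its sign is absorbed into the second
    vector, so that the scalar becomes the positive number \<open>\<bar>Im a\<bar>\<close>.\<close>
  define e :: real where "e = sgn (Im a)"
  have e: "e * e = 1" "e * Im a = \<bar>Im a\<bar>" "Im a * e = \<bar>Im a\<bar>" "e * \<bar>Im a\<bar> = Im a"
    using Im0 unfolding e_def by (auto simp: sgn_if)
  show ?thesis
  proof (rule that[of "(1 / r) \<cdot>\<^sub>v x" "(e / r) \<cdot>\<^sub>v y" "\<bar>Im a\<bar>"])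
    show "((1 / r) \<cdot>\<^sub>v x) \<bullet> ((1 / r) \<cdot>\<^sub>v x) = 1"
      "((e / r) \<cdot>\<^sub>v y) \<bullet> ((e / r) \<cdot>\<^sub>v y) = 1"
      "((1 / r) \<cdot>\<^sub>v x) \<bullet> ((e / r) \<cdot>\<^sub>v y) = 0"
      using x y r e(1) by (auto simp: xy eq field_simps)
    show "B *\<^sub>v ((1 / r) \<cdot>\<^sub>v x) = (- \<bar>Im a\<bar>) \<cdot>\<^sub>v ((e / r) \<cdot>\<^sub>v y)"
      using B x y e by (simp add: mult_mat_vec[of _ n n] Bx' smult_smult_assoc mult.commute)
    show "B *\<^sub>v ((e / r) \<cdot>\<^sub>v y) = \<bar>Im a\<bar> \<cdot>\<^sub>v ((1 / r) \<cdot>\<^sub>v x)"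
      using B x y e by (simp add: mult_mat_vec[of _ n n] By' smult_smult_assoc)
  qed (use x y Im0 in auto)
qed

section \<open>Splitting off orthonormal pairs by deflation\<close>

lemma exists_orthogonal_vec:
  fixes w :: "nat \<Rightarrow> 'a :: idom vec"
  assumes w: "\<And>i. i < m \<Longrightarrow> w i \<in> carrier_vec n" and "m < n"
  shows "\<exists>x \<in> carrier_vec n. x \<noteq> 0\<^sub>v n \<and> (\<forall>i<m. w i \<bullet> x = 0)"
proof -
  \<comment> \<open>The given vectors become the first rows of a square matrix whose rows from
    \<open>m\<close> on are zero. Its determinant vanishes because \<open>m < n\<close>, and a
    kernel vector is orthogonal to every \<open>w i\<close>.\<close>
  define c where "c i = (if i < m then w i else 0\<^sub>v n)" for i
  let ?M = "mat\<^sub>r n n (\<lambda>i. if i = m then 0\<^sub>v n else c i)"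
  have "det ?M = 0"
    by (rule det_row_0[OF \<open>m < n\<close>]) (use w in \<open>auto simp: c_def\<close>)
  then obtain x where x: "x \<in> carrier_vec n" "x \<noteq> 0\<^sub>v n" "?M *\<^sub>v x = 0\<^sub>v n"
    using det_0_iff_vec_prod_zero[of ?M n] by auto
  have "w i \<bullet> x = 0" if "i < m" for i
    using arg_cong[OF x(3), of "\<lambda>y. y $ i"] that \<open>m < n\<close> w[OF that] by (auto simp: c_def)
  with x show ?thesis
    by blast
qed

text \<open>The signs are those obtained by applying
  \<open>A = U \<Sigma> V\<^sup>T - V \<Sigma> U\<^sup>T\<close> to the columns of \<open>U\<close>
  and \<open>V\<close>; \<open>k\<close> counts the pairs found so far.\<close>

definition skew_pairs ::
    "real mat \<Rightarrow> nat \<Rightarrow> nat \<Rightarrow> (nat \<Rightarrow> real vec) \<Rightarrow> (nat \<Rightarrow> real vec) \<Rightarrow> (nat \<Rightarrow> real) \<Rightarrow> bool" where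
  "skew_pairs A n k u v s \<longleftrightarrow>
     (\<forall>i<k. u i \<in> carrier_vec n \<and> v i \<in> carrier_vec n \<and> s i > 0 \<and>
       A *\<^sub>v u i = (- s i) \<cdot>\<^sub>v v i \<and> A *\<^sub>v v i = s i \<cdot>\<^sub>v u i) \<and>
     (\<forall>i<k. \<forall>j<k. u i \<bullet> u j = (if i = j then 1 else 0) \<and>
       v i \<bullet> v j = (if i = j then 1 else 0) \<and> u i \<bullet> v j = 0)"

text \<open>The new pair is taken from the deflated matrix \<open>B\<close>. The old vectors lie in
  the kernel of \<open>B\<close>, so the new pair is orthogonal to them; there \<open>B\<close> and
  \<open>A\<close> act alike, so its relations carry over to \<open>A\<close>.\<close>

lemma skew_pairs_extend:
  assumes A: "A \<in> carrier_mat n n" and inv: "invertible_mat A" and skew: "transpose_mat A = - A"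
    and pairs: "skew_pairs A n k u v s" and k: "2 * k < n"
  shows "\<exists>u v s. skew_pairs A n (Suc k) u v s"
proof -
  have uc: "u i \<in> carrier_vec n" and vc: "v i \<in> carrier_vec n" if "i < k" for i
    using pairs that unfolding skew_pairs_def by auto
  define B where "B = mat n n (\<lambda>(i, j).
    A $$ (i, j) - (\<Sum>m<k. s m * (u m $ i * v m $ j - v m $ i * u m $ j)))"
  have B: "B \<in> carrier_mat n n"
    unfolding B_def by simp
  have A_swap: "A $$ (j, i) = - A $$ (i, j)" if "i < n" "j < n" for i j
    using arg_cong[OF skew, of "\<lambda>M. M $$ (i, j)"] A that by auto
  have B_skew: "transpose_mat B = - B"
  proof (rule eq_matI)
    fix i j assume "i < dim_row (- B)" "j < dim_col (- B)"
    hence ij: "i < n" "j < n"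
      using B by auto
    have "(\<Sum>m<k. s m * (u m $ j * v m $ i - v m $ j * u m $ i))
        = - (\<Sum>m<k. s m * (u m $ i * v m $ j - v m $ i * u m $ j))"
      unfolding sum_negf[symmetric] by (intro sum.cong refl) (simp add: algebra_simps)
    thus "transpose_mat B $$ (i, j) = (- B) $$ (i, j)"
      using ij by (simp add: B_def A_swap[OF ij])
  qed (use B in auto)
  \<comment> \<open>Each subtracted rank-two term sees \<open>x\<close> only through its scalar
    products with \<open>u m\<close> and \<open>v m\<close>.\<close>
  have Bx: "(B *\<^sub>v x) $ i = (A *\<^sub>v x) $ i - (\<Sum>m<k. s m * (u m $ i * (v m \<bullet> x) - v m $ i * (u m \<bullet> x)))"
    if "x \<in> carrier_vec n" "i < n" for x i
  proof -
    have "(B *\<^sub>v x) $ i = (\<Sum>j=0..<n.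
        (A $$ (i, j) - (\<Sum>m<k. s m * (u m $ i * v m $ j - v m $ i * u m $ j))) * x $ j)"
      using that by (simp add: B_def scalar_prod_def)
    also have "\<dots> = (\<Sum>j=0..<n. A $$ (i, j) * x $ j)
        - (\<Sum>j=0..<n. \<Sum>m<k. s m * (u m $ i * v m $ j - v m $ i * u m $ j) * x $ j)"
      by (simp only: left_diff_distrib sum_subtractf sum_distrib_right)
    also have "(\<Sum>j=0..<n. A $$ (i, j) * x $ j) = (A *\<^sub>v x) $ i"
      using that A by (simp add: scalar_prod_def)
    also have "(\<Sum>j=0..<n. \<Sum>m<k. s m * (u m $ i * v m $ j - v m $ i * u m $ j) * x $ j)
        = (\<Sum>m<k. \<Sum>j=0..<n. s m * (u m $ i * (v m $ j * x $ j) - v m $ i * (u m $ j * x $ j)))"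
      by (subst sum.swap) (simp add: algebra_simps)
    also have "\<dots> = (\<Sum>m<k. s m * (u m $ i * (v m \<bullet> x) - v m $ i * (u m \<bullet> x)))"
      using that by (simp only: scalar_prod_def carrier_vecD sum_distrib_left[symmetric] sum_subtractf)
    finally show ?thesis .
  qed
  have B_eq_A: "B *\<^sub>v x = A *\<^sub>v x"
    if x: "x \<in> carrier_vec n" and "\<And>i. i < k \<Longrightarrow> u i \<bullet> x = 0 \<and> v i \<bullet> x = 0" for x
    by (rule eq_vecI) (use that A B in \<open>auto simp: Bx simp del: index_mult_mat_vec\<close>)
  have B_u: "B *\<^sub>v u j = 0\<^sub>v n" and B_v: "B *\<^sub>v v j = 0\<^sub>v n" if "j < k" for j
  proof -
    have "v m \<bullet> u j = 0" if "m < k" for m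
      using pairs \<open>j < k\<close> that comm_scalar_prod[OF vc[OF that] uc[OF \<open>j < k\<close>]]
      unfolding skew_pairs_def by auto
    hence *: "v m \<bullet> u j = 0" "u m \<bullet> u j = (if m = j then 1 else 0)" "u m \<bullet> v j = 0"
      "v m \<bullet> v j = (if m = j then 1 else 0)" if "m < k" for m
      using pairs \<open>j < k\<close> that unfolding skew_pairs_def by auto
    have Auv: "A *\<^sub>v u j = (- s j) \<cdot>\<^sub>v v j" "A *\<^sub>v v j = s j \<cdot>\<^sub>v u j"
      using pairs \<open>j < k\<close> unfolding skew_pairs_def by auto
    have "(B *\<^sub>v u j) $ i = 0" if "i < n" for i
    proof -
      \<comment> \<open>Orthonormality leaves only the summand \<open>m = j\<close>, which equals
        the contribution of \<open>A\<close>.\<close>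
      have "(B *\<^sub>v u j) $ i = - s j * v j $ i - (\<Sum>m<k. if m = j then - s j * v j $ i else 0)"
        unfolding Bx[OF uc[OF \<open>j < k\<close>] that] Auv using that vc[OF \<open>j < k\<close>]
        by (intro arg_cong2[of _ _ _ _ "(-)"] sum.cong) (auto simp: *)
      thus ?thesis using \<open>j < k\<close> by simp
    qed
    thus "B *\<^sub>v u j = 0\<^sub>v n"
      using B by (intro eq_vecI) auto
    have "(B *\<^sub>v v j) $ i = 0" if "i < n" for i
    proof -
      have "(B *\<^sub>v v j) $ i = s j * u j $ i - (\<Sum>m<k. if m = j then s j * u j $ i else 0)"
        unfolding Bx[OF vc[OF \<open>j < k\<close>] that] Auv using that uc[OF \<open>j < k\<close>]
        by (intro arg_cong2[of _ _ _ _ "(-)"] sum.cong) (auto simp: *)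
      thus ?thesis using \<open>j < k\<close> by simp
    qed
    thus "B *\<^sub>v v j = 0\<^sub>v n"
      using B by (intro eq_vecI) auto
  qed
  have "B \<noteq> 0\<^sub>m n n"
  proof
    assume B0: "B = 0\<^sub>m n n"
    \<comment> \<open>The \<open>2 * k\<close> vectors found so far in one list, first the
      \<open>u i\<close>, then the \<open>v i\<close>. A nonzero vector orthogonal to all of them
      would be killed by \<open>A\<close> if \<open>B\<close> were zero, contradicting
      invertibility.\<close>
    define w where "w i = (if i < k then u i else v (i - k))" for i
    have "\<exists>x \<in> carrier_vec n. x \<noteq> 0\<^sub>v n \<and> (\<forall>i<2*k. w i \<bullet> x = 0)"
      by (rule exists_orthogonal_vec[OF _ k]) (auto simp: w_def uc vc)
    then obtain x where x: "x \<in> carrier_vec n" "x \<noteq> 0\<^sub>v n" and wx: "\<And>i. i < 2*k \<Longrightarrow> w i \<bullet> x = 0"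
      by blast
    have "u i \<bullet> x = 0 \<and> v i \<bullet> x = 0" if "i < k" for i
      using wx[of i] wx[of "i + k"] that by (auto simp: w_def)
    hence "A *\<^sub>v x = B *\<^sub>v x"
      using B_eq_A x by simp
    hence Ax: "A *\<^sub>v x = 0\<^sub>v n"
      using x unfolding B0 by auto
    from inv A obtain C where C: "C * A = 1\<^sub>m (dim_row C)" "A * C = 1\<^sub>m n"
      unfolding invertible_mat_def inverts_mat_def by auto
    \<comment> \<open>The dimensions of \<open>C\<close> are read off from those of the two identity
      matrices.\<close>
    have "C \<in> carrier_mat n n"
      using C A by (metis carrier_matD carrier_matI index_mult_mat(2,3) index_one_mat(2,3))
    hence "x = C *\<^sub>v (A *\<^sub>v x)"
      using C A x assoc_mult_mat_vec[of C n n A n x] by auto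
    also have "\<dots> = 0\<^sub>v n"
      using \<open>C \<in> carrier_mat n n\<close> unfolding Ax by auto
    finally show False
      using x by simp
  qed
  from skew_singular_pair[OF B B_skew this] obtain p q t where pq:
    "p \<in> carrier_vec n" "q \<in> carrier_vec n" "t > 0" "p \<bullet> p = 1" "q \<bullet> q = 1" "p \<bullet> q = 0"
    "B *\<^sub>v p = (- t) \<cdot>\<^sub>v q" "B *\<^sub>v q = t \<cdot>\<^sub>v p"
    by blast
  \<comment> \<open>The kernel of \<open>B\<close> is orthogonal to its range, and \<open>B\<close>
    maps \<open>p\<close> and \<open>q\<close> to nonzero multiples of \<open>q\<close> and
    \<open>p\<close>.\<close>
  have orth: "w \<bullet> p = 0 \<and> w \<bullet> q = 0" if w: "w \<in> carrier_vec n" and "B *\<^sub>v w = 0\<^sub>v n" for w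
    using skew_scalar_prod[OF B B_skew w pq(1)] skew_scalar_prod[OF B B_skew w pq(2)] that pq by auto
  have orth_u: "u i \<bullet> p = 0" "u i \<bullet> q = 0" "p \<bullet> u i = 0" "q \<bullet> u i = 0" if "i < k" for i
    using orth[OF uc B_u, OF that that] comm_scalar_prod[OF pq(1) uc[OF that]]
      comm_scalar_prod[OF pq(2) uc[OF that]] by simp_all
  have orth_v: "v i \<bullet> p = 0" "v i \<bullet> q = 0" "p \<bullet> v i = 0" "q \<bullet> v i = 0" if "i < k" for i
    using orth[OF vc B_v, OF that that] comm_scalar_prod[OF pq(1) vc[OF that]]
      comm_scalar_prod[OF pq(2) vc[OF that]] by simp_all
  have Apq: "A *\<^sub>v p = (- t) \<cdot>\<^sub>v q" "A *\<^sub>v q = t \<cdot>\<^sub>v p"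
    using B_eq_A[of p] B_eq_A[of q] pq orth_u orth_v by auto
  have "skew_pairs A n (Suc k) (u(k := p)) (v(k := q)) (s(k := t))"
    using pairs pq orth_u orth_v Apq unfolding skew_pairs_def less_Suc_eq by auto
  thus ?thesis
    by blast
qed

lemma skew_pairs_exist:
  assumes "A \<in> carrier_mat n n" "invertible_mat A" "transpose_mat A = - A" "2 * k \<le> n"
  shows "\<exists>u v s. skew_pairs A n k u v s"
  using \<open>2 * k \<le> n\<close>
proof (induction k)
  case 0
  show ?case
    by (simp add: skew_pairs_def)
next
  case (Suc k)
  then obtain u v s where "skew_pairs A n k u v s"
    by auto
  thus ?case
    using skew_pairs_extend[OF assms(1-3)] Suc.prems by simp
qed

section \<open>Products of block matrices, and criteria for orthogonal and unitary matrices\<close>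

lemma block_row_carrier:
  assumes "A \<in> carrier_mat n k" "B \<in> carrier_mat n m"
  shows "block_row A B \<in> carrier_mat n (k + m)"
  using assms unfolding block_row_def by (intro carrier_matI) auto

lemma index_block_row:
  assumes "A \<in> carrier_mat n k" "B \<in> carrier_mat n m" "i < n" "j < k + m"
  shows "block_row A B $$ (i, j) = (if j < k then A $$ (i, j) else B $$ (i, j - k))"
  using assms unfolding block_row_def by auto

text \<open>Entries of the product are scalar products of columns, so the column ranges separate
  into four blocks. With equal or conjugate factors this computes Gram matrices.\<close>

lemma transpose_block_row_mult:
  fixes A B C D :: "'a :: comm_semiring_0 mat"
  assumes "A \<in> carrier_mat n k" "B \<in> carrier_mat n m" "C \<in> carrier_mat n p" "D \<in> carrier_mat n q"
  shows "transpose_mat (block_row A B) * block_row C D =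
    four_block_mat (transpose_mat A * C) (transpose_mat A * D)
      (transpose_mat B * C) (transpose_mat B * D)"
proof -
  have A: "col (block_row A B) j = (if j < k then col A j else col B (j - k))" if "j < k + m" for j
    using that assms block_row_carrier[OF assms(1,2)] by (intro eq_vecI) (auto simp: index_block_row)
  have B: "col (block_row C D) j = (if j < p then col C j else col D (j - p))" if "j < p + q" for j
    using that assms block_row_carrier[OF assms(3,4)] by (intro eq_vecI) (auto simp: index_block_row)
  show ?thesis
    using assms block_row_carrier[OF assms(1,2)] block_row_carrier[OF assms(3,4)]
    by (intro eq_matI) (auto simp: A B)
qed

text \<open>Both decompositions in the theorem have this shape; the formula reduces each to a sum of
  two ordinary products.\<close>

lemma block_row_mult_diag2_mult_transpose:
  fixes A B C D S T :: "'a :: comm_semiring_0 mat"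
  assumes A: "A \<in> carrier_mat n k" and B: "B \<in> carrier_mat n m"
    and S: "S \<in> carrier_mat k k" and T: "T \<in> carrier_mat m m"
    and C: "C \<in> carrier_mat p k" and D: "D \<in> carrier_mat p m"
  shows "block_row A B * block_diag2 S T * transpose_mat (block_row C D) =
    A * S * transpose_mat C + B * T * transpose_mat D"
proof -
  have "block_row A B * block_diag2 S T = four_block_mat (A * S) (B * T) (0\<^sub>m 0 k) (0\<^sub>m 0 m)"
    using assms unfolding block_row_def block_diag2_def
    by (subst mult_four_block_mat[where ?nr2.0 = 0 and ?n1.0 = k and ?n2.0 = m and ?nc1.0 = k and ?nc2.0 = m])
      auto
  also have "\<dots> * transpose_mat (block_row C D) =
      four_block_mat (A * S * transpose_mat C + B * T * transpose_mat D)
        (0\<^sub>m n 0) (0\<^sub>m 0 p) (0\<^sub>m 0 0)"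
    using assms unfolding block_row_def
    by (subst transpose_four_block_mat[where ?nr2.0 = 0],
        (auto)[4], subst mult_four_block_mat[where ?nr2.0 = 0 and ?nc2.0 = 0 and ?n1.0 = k and ?n2.0 = m])
      (auto intro!: eq_matI)
  \<comment> \<open>The other three blocks have no rows or no columns.\<close>
  also have "\<dots> = A * S * transpose_mat C + B * T * transpose_mat D"
    using assms by (intro eq_matI) auto
  finally show ?thesis .
qed

lemma block_diag2_one: "block_diag2 (1\<^sub>m k) (1\<^sub>m m) = 1\<^sub>m (k + m)"
  unfolding block_diag2_def by simp

lemma diagonal_mat_block_diag2:
  assumes "S \<in> carrier_mat k k" "T \<in> carrier_mat m m" "diagonal_mat S" "diagonal_mat T"
  shows "diagonal_mat (block_diag2 S T)"
  using assms unfolding diagonal_mat_def block_diag2_def by (auto split: if_splits)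

text \<open>A left inverse of a square matrix is also a right inverse.\<close>

lemma orthonormal_square_matI:
  assumes "Q \<in> carrier_mat n n" "transpose_mat Q * Q = 1\<^sub>m n"
  shows "orthonormal_square_mat Q"
  using assms mat_mult_left_right_inverse[of "transpose_mat Q" n Q]
  unfolding orthonormal_square_mat_def by auto

lemma mat_adjoint_eq_transpose: "mat_adjoint X = transpose_mat (map_mat cnj X)"
  by (rule eq_matI) (auto simp: mat_adjoint_def mat_of_rows_def)

lemma unitary_matI:
  assumes "X \<in> carrier_mat n n" "mat_adjoint X * X = 1\<^sub>m n"
  shows "unitary_mat X"
  using assms mat_mult_left_right_inverse[of "mat_adjoint X" n X]
  unfolding unitary_mat_def mat_adjoint_eq_transpose by auto

lemma map_mat_block_row:
  assumes "A \<in> carrier_mat n k" "B \<in> carrier_mat n m"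
  shows "map_mat f (block_row A B) = block_row (map_mat f A) (map_mat f B)"
  using assms by (intro eq_matI) (auto simp: block_row_def)

text \<open>Unitarity of \<open>X\<close> makes \<open>A\<close> similar to \<open>L\<close>, so the
  characteristic polynomials agree; that of the triangular matrix \<open>L\<close> factors along its
  diagonal.\<close>

lemma spectral_decompositionI:
  assumes A: "A \<in> carrier_mat n n" and X: "X \<in> carrier_mat n n" and L: "L \<in> carrier_mat n n"
    and un: "mat_adjoint X * X = 1\<^sub>m n" and diag: "diagonal_mat L"
    and eq: "A = X * L * mat_adjoint X"
  shows "spectral_decomposition A X L"
proof -
  have XH: "mat_adjoint X \<in> carrier_mat n n"
    using X by (simp add: mat_adjoint_eq_transpose)
  have "similar_mat A L"
    by (rule similar_matI[of A L X "mat_adjoint X" n])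
      (use A X L XH un eq mat_mult_left_right_inverse[OF XH X un] in auto)
  moreover have "upper_triangular L"
    using diag L unfolding diagonal_mat_def by auto
  ultimately have "char_poly A = (\<Prod>a\<leftarrow>diag_mat L. [:- a, 1:])"
    using char_poly_similar[of A L] char_poly_upper_triangular[OF L] by simp
  thus ?thesis
    using assms unitary_matI[OF X un] unfolding spectral_decomposition_def by auto
qed

section \<open>The complex columns built from \<open>U\<close> and \<open>V\<close>\<close>

definition conj_pair :: "real mat \<Rightarrow> real mat \<Rightarrow> complex \<Rightarrow> complex mat" where
  "conj_pair U V s = complex_of_real (1 / sqrt 2) \<cdot>\<^sub>m (cmat U + s \<cdot>\<^sub>m cmat V)"

lemma conj_pair_carrier:
  assumes "U \<in> carrier_mat n k" "V \<in> carrier_mat n k"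
  shows "conj_pair U V s \<in> carrier_mat n k"
  using assms unfolding conj_pair_def by simp

lemma of_real_sqrt2_mult: "complex_of_real (sqrt 2) * complex_of_real (sqrt 2) = 2"
  by (simp flip: of_real_mult)

text \<open>The mixed terms vanish by biorthogonality. The transpose is not conjugated: conjugation
  is expressed by the choice of \<open>s\<close>. The factor is 1 for \<open>s = - \<i>\<close>,
  \<open>t = \<i>\<close> and 0 for \<open>s = t = \<i>\<close> or \<open>s = t = - \<i>\<close>, so
  all blocks of the Gram matrix of \<open>X\<close> are covered.\<close>

lemma transpose_conj_pair_mult:
  assumes U: "U \<in> carrier_mat n k" and V: "V \<in> carrier_mat n k"
    and UU: "transpose_mat U * U = 1\<^sub>m k" and VV: "transpose_mat V * V = 1\<^sub>m k"
    and UV: "transpose_mat U * V = 0\<^sub>m k k"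
  shows "transpose_mat (conj_pair U V s) * conj_pair U V t = ((1 + s * t) / 2) \<cdot>\<^sub>m 1\<^sub>m k"
proof (rule eq_matI)
  fix i j assume "i < dim_row (((1 + s * t) / 2) \<cdot>\<^sub>m 1\<^sub>m k)" "j < dim_col (((1 + s * t) / 2) \<cdot>\<^sub>m 1\<^sub>m k)"
  hence ij: "i < k" "j < k"
    by auto
  have "(\<Sum>m<n. U $$ (m, i) * U $$ (m, j)) = (if i = j then 1 else 0)"
    "(\<Sum>m<n. V $$ (m, i) * V $$ (m, j)) = (if i = j then 1 else 0)"
    "(\<Sum>m<n. U $$ (m, i) * V $$ (m, j)) = 0" "(\<Sum>m<n. V $$ (m, i) * U $$ (m, j)) = 0"
    using ij U V arg_cong[OF UU, of "\<lambda>M. M $$ (i, j)"] arg_cong[OF VV, of "\<lambda>M. M $$ (i, j)"]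
      arg_cong[OF UV, of "\<lambda>M. M $$ (i, j)"] arg_cong[OF UV, of "\<lambda>M. M $$ (j, i)"]
    by (auto simp: scalar_prod_def lessThan_atLeast0 mult.commute)
  note sums = this[THEN arg_cong[of _ _ complex_of_real], unfolded of_real_sum of_real_mult]
  have "(transpose_mat (conj_pair U V s) * conj_pair U V t) $$ (i, j) =
      (\<Sum>m<n. 1 / 2 * ((U $$ (m, i) + s * V $$ (m, i)) * (U $$ (m, j) + t * V $$ (m, j))))"
    using ij U V
    by (simp add: conj_pair_def scalar_prod_def lessThan_atLeast0 mult_ac of_real_sqrt2_mult)
  also have "\<dots> = 1 / 2 * ((\<Sum>m<n. U $$ (m, i) * U $$ (m, j)) + t * (\<Sum>m<n. U $$ (m, i) * V $$ (m, j))
      + s * (\<Sum>m<n. V $$ (m, i) * U $$ (m, j)) + s * t * (\<Sum>m<n. V $$ (m, i) * V $$ (m, j)))"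
    by (simp add: sum_distrib_left sum.distrib algebra_simps)
  also have "\<dots> = (((1 + s * t) / 2) \<cdot>\<^sub>m 1\<^sub>m k) $$ (i, j)"
    using ij by (simp add: sums)
  finally show "(transpose_mat (conj_pair U V s) * conj_pair U V t) $$ (i, j) = (((1 + s * t) / 2) \<cdot>\<^sub>m 1\<^sub>m k) $$ (i, j)" .
qed (use U V in \<open>auto simp: conj_pair_def\<close>)

text \<open>The two summands are complex conjugates of each other, so the imaginary contributions of
  \<open>U * D * U\<^sup>T\<close> and \<open>V * D * V\<^sup>T\<close> cancel and twice the real
  part remains.\<close>

lemma conj_pair_diag_sum:
  fixes \<sigma> :: "nat \<Rightarrow> real"
  assumes U: "U \<in> carrier_mat n k" and V: "V \<in> carrier_mat n k"
  defines "D \<equiv> mat_diag k \<sigma>"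
  shows "conj_pair U V \<i> * (\<i> \<cdot>\<^sub>m cmat D) * transpose_mat (conj_pair U V (- \<i>))
      + conj_pair U V (- \<i>) * (- (\<i> \<cdot>\<^sub>m cmat D)) * transpose_mat (conj_pair U V \<i>)
    = cmat (U * D * transpose_mat V - V * D * transpose_mat U)"
proof -
  have D: "\<i> \<cdot>\<^sub>m cmat D = mat_diag k (\<lambda>m. \<i> * \<sigma> m)" "- (\<i> \<cdot>\<^sub>m cmat D) = mat_diag k (\<lambda>m. - \<i> * \<sigma> m)"
    unfolding D_def mat_diag_def by (auto intro!: eq_matI)
  have summand: "1 / 2 * ((complex_of_real a + \<i> * complex_of_real b) * (\<i> * complex_of_real r)
        * (complex_of_real c + (- \<i>) * complex_of_real d))
      + 1 / 2 * ((complex_of_real a + (- \<i>) * complex_of_real b) * (- \<i> * complex_of_real r)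
        * (complex_of_real c + \<i> * complex_of_real d))
      = complex_of_real (a * r * d - b * r * c)" for a b c d r
    by (simp add: complex_eq_iff algebra_simps)
  show ?thesis
  proof (rule eq_matI)
    fix i j
    assume "i < dim_row (cmat (U * D * transpose_mat V - V * D * transpose_mat U))"
      "j < dim_col (cmat (U * D * transpose_mat V - V * D * transpose_mat U))"
    hence ij: "i < n" "j < n"
      using U V by auto
    have *: "(conj_pair U V s * mat_diag k f * transpose_mat (conj_pair U V t)) $$ (i, j) =
        (\<Sum>m<k. 1 / 2 * ((U $$ (i, m) + s * V $$ (i, m)) * f m * (U $$ (j, m) + t * V $$ (j, m))))" for s t :: complex and f
      unfolding mat_diag_mult_right[OF conj_pair_carrier[OF U V]] using ij U V
      by (simp add: conj_pair_def scalar_prod_def lessThan_atLeast0 mult_ac of_real_sqrt2_mult)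
    have "(conj_pair U V \<i> * (\<i> \<cdot>\<^sub>m cmat D) * transpose_mat (conj_pair U V (- \<i>))
        + conj_pair U V (- \<i>) * (- (\<i> \<cdot>\<^sub>m cmat D)) * transpose_mat (conj_pair U V \<i>)) $$ (i, j) =
        (\<Sum>m<k. of_real (U $$ (i, m) * \<sigma> m * V $$ (j, m) - V $$ (i, m) * \<sigma> m * U $$ (j, m)))"
      \<comment> \<open>The order matters: the left side of \<open>D(1)\<close> occurs inside that
        of \<open>D(2)\<close>.\<close>
      unfolding D(2) unfolding D(1) using ij carrier_matD(1)[OF conj_pair_carrier[OF U V]]
      by (subst index_add_mat)
        (simp_all only: * sum.distrib[symmetric] summand index_mult_mat index_transpose_mat)
    also have "\<dots> = cmat (U * D * transpose_mat V - V * D * transpose_mat U) $$ (i, j)"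
      unfolding D_def using ij U V mat_diag_mult_right[OF U] mat_diag_mult_right[OF V]
      by (simp add: scalar_prod_def lessThan_atLeast0 sum_subtractf)
    finally show "(conj_pair U V \<i> * (\<i> \<cdot>\<^sub>m cmat D) * transpose_mat (conj_pair U V (- \<i>))
        + conj_pair U V (- \<i>) * (- (\<i> \<cdot>\<^sub>m cmat D)) * transpose_mat (conj_pair U V \<i>)) $$ (i, j)
        = cmat (U * D * transpose_mat V - V * D * transpose_mat U) $$ (i, j)" .
  qed (use U V in \<open>auto simp: conj_pair_def\<close>)
qed

section \<open>Assembling the two decompositions\<close>

lemma transpose_mult_eq_zero_swap:
  fixes U V :: "'a :: comm_semiring_0 mat"
  assumes "U \<in> carrier_mat n k" "V \<in> carrier_mat n m" "transpose_mat U * V = 0\<^sub>m k m"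
  shows "transpose_mat V * U = 0\<^sub>m m k"
proof -
  have "transpose_mat V * U = transpose_mat (transpose_mat U * V)"
    using assms(1,2) by (subst transpose_mult[of _ k n _ m]) auto
  thus ?thesis
    unfolding assms(3) by simp
qed

lemma orthonormal_block_row:
  assumes U: "U \<in> carrier_mat n k" and V: "V \<in> carrier_mat n k" and n: "n = 2 * k"
    and UU: "transpose_mat U * U = 1\<^sub>m k" and VV: "transpose_mat V * V = 1\<^sub>m k"
    and UV: "transpose_mat U * V = 0\<^sub>m k k"
  shows "orthonormal_square_mat (block_row U V)"
proof (rule orthonormal_square_matI[of _ n])
  show "block_row U V \<in> carrier_mat n n"
    using block_row_carrier[OF U V] n by (simp add: mult_2)
  note VU = transpose_mult_eq_zero_swap[OF U V UV]
  show "transpose_mat (block_row U V) * block_row U V = 1\<^sub>m n"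
    unfolding transpose_block_row_mult[OF U V U V] UU VV UV VU n by (simp add: mult_2)
qed

text \<open>This is \<open>Q * Q\<^sup>T = 1\<close> for \<open>Q = [U V]\<close>, with an identity
  inserted as a block diagonal matrix so that the block product formula applies.\<close>

lemma block_row_complete:
  assumes U: "U \<in> carrier_mat n k" and V: "V \<in> carrier_mat n k"
    and "orthonormal_square_mat (block_row U V)"
  shows "U * transpose_mat U + V * transpose_mat V = 1\<^sub>m n"
proof -
  have "1\<^sub>m n = block_row U V * block_diag2 (1\<^sub>m k) (1\<^sub>m k) * transpose_mat (block_row U V)"
    using assms block_row_carrier[OF U V] unfolding block_diag2_one orthonormal_square_mat_def
    by simp
  also have "\<dots> = U * transpose_mat U + V * transpose_mat V"
    using U V by (subst block_row_mult_diag2_mult_transpose[OF U V _ _ U V]) auto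
  finally show ?thesis ..
qed

lemma skew_factorization:
  fixes A :: "real mat"
  assumes A: "A \<in> carrier_mat n n" and U: "U \<in> carrier_mat n k" and V: "V \<in> carrier_mat n k"
    and D: "D \<in> carrier_mat k k" and AU: "A * U = - (V * D)" and AV: "A * V = U * D"
    and compl: "U * transpose_mat U + V * transpose_mat V = 1\<^sub>m n"
  shows "A = U * D * transpose_mat V - V * D * transpose_mat U"
proof -
  have "A = A * (U * transpose_mat U + V * transpose_mat V)"
    using A unfolding compl by simp
  also have "\<dots> = A * U * transpose_mat U + A * V * transpose_mat V"
    using A U V by (simp add: mult_add_distrib_mat[of _ n n _ n])
  also have "\<dots> = U * D * transpose_mat V - V * D * transpose_mat U"
    unfolding AU AV using U V D by (intro eq_matI) auto
  finally show ?thesis .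
qed

lemma map_mat_cnj_conj_pair: "map_mat cnj (conj_pair U V s) = conj_pair U V (cnj s)"
  if "U \<in> carrier_mat n k" "V \<in> carrier_mat n k"
  using that by (intro eq_matI) (auto simp: conj_pair_def)

lemma spectral_decomposition_skew:
  assumes A: "A \<in> carrier_mat n n" and n: "n = 2 * k"
    and U: "U \<in> carrier_mat n k" and V: "V \<in> carrier_mat n k"
    and UU: "transpose_mat U * U = 1\<^sub>m k" and VV: "transpose_mat V * V = 1\<^sub>m k"
    and UV: "transpose_mat U * V = 0\<^sub>m k k"
    and eq: "A = U * mat_diag k \<sigma> * transpose_mat V - V * mat_diag k \<sigma> * transpose_mat U"
  shows "spectral_decomposition (cmat A) (block_row (conj_pair U V \<i>) (conj_pair U V (- \<i>)))
    (block_diag2 (\<i> \<cdot>\<^sub>m cmat (mat_diag k \<sigma>)) (- (\<i> \<cdot>\<^sub>m cmat (mat_diag k \<sigma>))))"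
proof (rule spectral_decompositionI)
  let ?X = "block_row (conj_pair U V \<i>) (conj_pair U V (- \<i>))"
  let ?S = "\<i> \<cdot>\<^sub>m cmat (mat_diag k \<sigma>)"
  note P = conj_pair_carrier[OF U V]
  have S: "?S \<in> carrier_mat k k" "- ?S \<in> carrier_mat k k"
    by (auto simp: mat_diag_def)
  \<comment> \<open>Conjugation swaps the two column blocks of \<open>X\<close>, which turns the
    adjoint into a plain transpose.\<close>
  have adj: "mat_adjoint ?X = transpose_mat (block_row (conj_pair U V (- \<i>)) (conj_pair U V \<i>))"
    unfolding mat_adjoint_eq_transpose map_mat_block_row[OF P P] map_mat_cnj_conj_pair[OF U V] by simp
  show "cmat A \<in> carrier_mat n n"
    using A by simp
  show "?X \<in> carrier_mat n n"
    using block_row_carrier[OF P P] n by (simp add: mult_2)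
  show "block_diag2 ?S (- ?S) \<in> carrier_mat n n"
    using S n unfolding block_diag2_def by (auto simp: mult_2)
  show "diagonal_mat (block_diag2 ?S (- ?S))"
    by (rule diagonal_mat_block_diag2[OF S]) (auto simp: diagonal_mat_def mat_diag_def)
  \<comment> \<open>The values of \<open>(1 + s * t) / 2\<close> for the diagonal and the
    off-diagonal blocks of the Gram matrix.\<close>
  have "((1 + 1) / 2 :: complex) \<cdot>\<^sub>m 1\<^sub>m k = 1\<^sub>m k" "((1 - 1) / 2 :: complex) \<cdot>\<^sub>m 1\<^sub>m k = 0\<^sub>m k k"
    by (auto intro!: eq_matI)
  thus "mat_adjoint ?X * ?X = 1\<^sub>m n"
    unfolding adj transpose_block_row_mult[OF P P P P] transpose_conj_pair_mult[OF U V UU VV UV] n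
    by (simp add: mult_2)
  show "cmat A = ?X * block_diag2 ?S (- ?S) * mat_adjoint ?X"
    unfolding adj block_row_mult_diag2_mult_transpose[OF P P S P P] conj_pair_diag_sum[OF U V] eq ..
qed

text \<open>The block product is \<open>U * D * V\<^sup>T + V * D * (- U)\<^sup>T\<close>, which is
  the assumed factorization. In the Gram matrix of \<open>[V -U]\<close> the two signs cancel in the
  block of \<open>- U\<close>, and the mixed blocks are zero.\<close>

lemma singular_value_decomposition_skew:
  assumes A: "A \<in> carrier_mat n n" and n: "n = 2 * k"
    and U: "U \<in> carrier_mat n k" and V: "V \<in> carrier_mat n k"
    and UU: "transpose_mat U * U = 1\<^sub>m k" and VV: "transpose_mat V * V = 1\<^sub>m k"
    and UV: "transpose_mat U * V = 0\<^sub>m k k"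
    and pos: "\<And>i. i < k \<Longrightarrow> \<sigma> i \<ge> 0"
    and eq: "A = U * mat_diag k \<sigma> * transpose_mat V - V * mat_diag k \<sigma> * transpose_mat U"
  shows "singular_value_decomposition A (block_row U V)
    (block_diag2 (mat_diag k \<sigma>) (mat_diag k \<sigma>)) (block_row V (- U))"
  unfolding singular_value_decomposition_def
proof (intro conjI allI impI)
  let ?S = "mat_diag k \<sigma>"
  have U': "- U \<in> carrier_mat n k"
    using U by simp
  show "block_row U V \<in> carrier_mat (dim_row A) (dim_row A)"
    using A block_row_carrier[OF U V] n by (simp add: mult_2)
  show "block_row V (- U) \<in> carrier_mat (dim_col A) (dim_col A)"
    using A block_row_carrier[OF V U'] n by (simp add: mult_2)
  show "block_diag2 ?S ?S \<in> carrier_mat (dim_row A) (dim_col A)"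
    using A n unfolding block_diag2_def by (auto simp: mult_2 mat_diag_def)
  show "orthonormal_square_mat (block_row U V)"
    by (rule orthonormal_block_row[OF U V n UU VV UV])
  have "transpose_mat V * (- U) = - (transpose_mat V * U)"
    using U V by (intro eq_matI) auto
  hence "transpose_mat V * (- U) = 0\<^sub>m k k"
    unfolding transpose_mult_eq_zero_swap[OF U V UV] by auto
  moreover have "transpose_mat (- U) * (- U) = 1\<^sub>m k"
    using U unfolding UU[symmetric] by (intro eq_matI) auto
  ultimately show "orthonormal_square_mat (block_row V (- U))"
    by (intro orthonormal_block_row[OF V U' n VV])
  show "diagonal_mat (block_diag2 ?S ?S)"
    by (rule diagonal_mat_block_diag2[of _ k _ k]) (auto simp: diagonal_mat_def mat_diag_def)
  show "block_diag2 ?S ?S $$ (i, i) \<ge> 0" if "i < min (dim_row A) (dim_col A)" for i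
    using that A pos n by (auto simp: block_diag2_def mat_diag_def)
  show "A = block_row U V * block_diag2 ?S ?S * transpose_mat (block_row V (- U))"
    unfolding block_row_mult_diag2_mult_transpose[OF U V mat_diag_dim mat_diag_dim V U'] eq
    using U V by (intro eq_matI) (auto simp: transpose_uminus carrier_matD[OF mat_diag_dim])
qed

theorem theorem2p1:
  fixes A :: "real mat" and n l :: nat
  assumes "n = 2 * l"
    and "A \<in> carrier_mat n n"
    and "invertible_mat A"
    and "transpose_mat A = - A"
  shows "\<exists>(U :: real mat) (V :: real mat) (\<Sigma> :: real mat) (\<sigma> :: nat \<Rightarrow> real).
      U \<in> carrier_mat n l \<and> V \<in> carrier_mat n l \<and>
      transpose_mat U * U = 1\<^sub>m l \<and>
      transpose_mat V * V = 1\<^sub>m l \<and>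
      transpose_mat U * V = 0\<^sub>m l l \<and>
      \<Sigma> = mat_diag l \<sigma> \<and> (\<forall>i<l. \<sigma> i > 0) \<and>
      spectral_decomposition (cmat A)
        (block_row (complex_of_real (1 / sqrt 2) \<cdot>\<^sub>m (cmat U + \<i> \<cdot>\<^sub>m cmat V))
                   (complex_of_real (1 / sqrt 2) \<cdot>\<^sub>m (cmat U - \<i> \<cdot>\<^sub>m cmat V)))
        (block_diag2 (\<i> \<cdot>\<^sub>m cmat \<Sigma>) (- (\<i> \<cdot>\<^sub>m cmat \<Sigma>))) \<and>
      singular_value_decomposition A
        (block_row U V) (block_diag2 \<Sigma> \<Sigma>) (block_row V (- U))"
proof -
  note A = assms(2)
  obtain u v \<sigma> where pairs: "skew_pairs A n l u v \<sigma>"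
    using skew_pairs_exist[OF assms(2-4), of l] assms(1) by auto
  \<comment> \<open>The vectors of the \<open>l\<close> pairs become the columns, so
    \<open>UU\<close>, \<open>VV\<close> and \<open>UV\<close> restate their orthonormality.\<close>
  define U where "U = mat n l (\<lambda>(i, j). u j $ i)"
  define V where "V = mat n l (\<lambda>(i, j). v j $ i)"
  have U: "U \<in> carrier_mat n l" and V: "V \<in> carrier_mat n l"
    unfolding U_def V_def by auto
  have vecs: "u i \<in> carrier_vec n" "v i \<in> carrier_vec n" "\<sigma> i > 0"
    "A *\<^sub>v u i = (- \<sigma> i) \<cdot>\<^sub>v v i" "A *\<^sub>v v i = \<sigma> i \<cdot>\<^sub>v u i" if "i < l" for i
    using pairs that unfolding skew_pairs_def by auto
  have prods: "u i \<bullet> u j = (if i = j then 1 else 0)" "v i \<bullet> v j = (if i = j then 1 else 0)"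
    "u i \<bullet> v j = 0" if "i < l" "j < l" for i j
    using pairs that unfolding skew_pairs_def by auto
  have cols: "col U j = u j" "col V j = v j" if "j < l" for j
    using that vecs(1,2)[OF that] unfolding U_def V_def by auto
  have UU: "transpose_mat U * U = 1\<^sub>m l" and VV: "transpose_mat V * V = 1\<^sub>m l"
    and UV: "transpose_mat U * V = 0\<^sub>m l l"
    using U V by (auto intro!: eq_matI simp: cols prods)
  have AU: "A * U = - (V * mat_diag l \<sigma>)"
  proof (rule eq_matI)
    fix i j assume "i < dim_row (- (V * mat_diag l \<sigma>))" "j < dim_col (- (V * mat_diag l \<sigma>))"
    hence ij: "i < n" "j < l"
      using V by (auto simp: mat_diag_def)
    have "(A * U) $$ (i, j) = (A *\<^sub>v u j) $ i"
      using ij A U by (simp add: cols)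
    thus "(A * U) $$ (i, j) = (- (V * mat_diag l \<sigma>)) $$ (i, j)"
      using ij vecs[OF ij(2)] unfolding mat_diag_mult_right[OF V] by (simp add: V_def)
  qed (use A U V in \<open>auto simp: mat_diag_def\<close>)
  have AV: "A * V = U * mat_diag l \<sigma>"
  proof (rule eq_matI)
    fix i j assume "i < dim_row (U * mat_diag l \<sigma>)" "j < dim_col (U * mat_diag l \<sigma>)"
    hence ij: "i < n" "j < l"
      using U by (auto simp: mat_diag_def)
    have "(A * V) $$ (i, j) = (A *\<^sub>v v j) $ i"
      using ij A V by (simp add: cols)
    thus "(A * V) $$ (i, j) = (U * mat_diag l \<sigma>) $$ (i, j)"
      using ij vecs[OF ij(2)] unfolding mat_diag_mult_right[OF U] by (simp add: U_def)
  qed (use A U V in \<open>auto simp: mat_diag_def\<close>)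
  \<comment> \<open>For \<open>n = 2 * l\<close> the columns of \<open>[U V]\<close> form a full
    orthonormal basis, so \<open>AU\<close> and \<open>AV\<close> determine
    \<open>A\<close>.\<close>
  have eq: "A = U * mat_diag l \<sigma> * transpose_mat V - V * mat_diag l \<sigma> * transpose_mat U"
    by (rule skew_factorization[OF A U V mat_diag_dim AU AV
          block_row_complete[OF U V orthonormal_block_row[OF U V assms(1) UU VV UV]]])
  have pair_i: "complex_of_real (1 / sqrt 2) \<cdot>\<^sub>m (cmat U + \<i> \<cdot>\<^sub>m cmat V) = conj_pair U V \<i>"
    "complex_of_real (1 / sqrt 2) \<cdot>\<^sub>m (cmat U - \<i> \<cdot>\<^sub>m cmat V) = conj_pair U V (- \<i>)"
    using U V unfolding conj_pair_def by (auto intro!: eq_matI)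
  have "spectral_decomposition (cmat A)
      (block_row (complex_of_real (1 / sqrt 2) \<cdot>\<^sub>m (cmat U + \<i> \<cdot>\<^sub>m cmat V))
        (complex_of_real (1 / sqrt 2) \<cdot>\<^sub>m (cmat U - \<i> \<cdot>\<^sub>m cmat V)))
      (block_diag2 (\<i> \<cdot>\<^sub>m cmat (mat_diag l \<sigma>)) (- (\<i> \<cdot>\<^sub>m cmat (mat_diag l \<sigma>))))"
    unfolding pair_i by (rule spectral_decomposition_skew[OF A assms(1) U V UU VV UV eq])
  moreover have "singular_value_decomposition A (block_row U V)
      (block_diag2 (mat_diag l \<sigma>) (mat_diag l \<sigma>)) (block_row V (- U))"
    by (rule singular_value_decomposition_skew[OF A assms(1) U V UU VV UV _ eq])
      (use vecs(3) in \<open>auto simp: less_imp_le\<close>)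
  ultimately show ?thesis
    using U V UU VV UV vecs(3) by blast
qed

end
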